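(* Let $H$ be a real Hilbert space, let $D$ and $P$ be orthogonal projectors onto closed subspaces $\mathbf D$ and $\mathbf P$ of $H$, and let $D^\perp=I-D$ and $P^\perp=I-P$ be the orthogonal projectors onto the orthogonal complements $\mathbf D^\perp$ and $\mathbf P^\perp$, respectively. Then the following equalities hold: $$\inf_{\psi\in\mathbf P,\ \psi\notin\mathbf D}\frac{\operatorname{dist}\{\psi;\mathbf D\}}{\operatorname{dist}\{\psi;\mathbf D\cap\mathbf P\}} =\inf_{\psi\in\mathbf D,\ \psi\notin\mathbf P}\frac{\operatorname{dist}\{\psi;\mathbf P\}}{\operatorname{dist}\{\psi;\mathbf P\cap\mathbf D\}}$$ $$=\inf_{\psi\in\mathbf D^\perp,\ \psi\notin\mathbf P^\perp}\frac{\operatorname{dist}\{\psi;\mathbf P^\perp\}}{\operatorname{dist}\{\psi;\mathbf P^\perp\cap\mathbf D^\perp\}} =\inf_{\psi\in\mathbf P^\perp,\ \psi\notin\mathbf D^\perp}\frac{\operatorname{dist}\{\psi;\mathbf D^\perp\}}{\operatorname{dist}\{\psi;\mathbf D^\perp\cap\mathbf P^\perp\}}$$ $$=\inf_{\psi\in P^\perp\mathbf D}\frac{\|D\psi\|}{\|\psi\|} =\inf_{\psi\in D^\perp\mathbf P}\frac{\|P\psi\|}{\|\psi\|} =\inf_{\psi\in P\mathbf D^\perp}\frac{\|D^\perp\psi\|}{\|\psi\|} =\inf_{\psi\in D\mathbf P^\perp}\frac{\|P^\perp\psi\|}{\|\psi\|}.$$ Moreover, each of the following statements is equivalent to the positiveness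 $\kappa>0$ of $\kappa:=\inf_{\psi\in P^\perp\mathbf D}\|D\psi\|/\|\psi\|$: (1) the subspace $P^\perp\mathbf D$ is closed; (2) the subspace $\mathbf D+\mathbf P$ is closed; (3) the subspace $\mathbf D^\perp+\mathbf P^\perp$ is closed; (4) the subspace $P\mathbf D^\perp$ is closed.
   Context: For a subspace $M$ of $H$ and a projector $Q$, $QM=\{Qx:x\in M\}$; a "subspace" is a linear manifold, not necessarily closed. $\operatorname{dist}\{\psi;M\}=\inf_{m\in M}\|\psi-m\|$. In the infima, arguments for which both the numerator and the denominator vanish are excluded.
   Formalization: An infimum over no admissible arguments is taken to be 1 (the infimum within [0,1], where all quotients lie); with the usual value +∞ the equalities fail, e.g. for D={0}, P=H≠{0}, where the first infimum is 1 and the second ranges over the empty set. *)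

theory Defs
  imports "HOL-Analysis.Analysis"
begin

definition orthogonal_projector :: "('a::real_inner \<Rightarrow> 'a) \<Rightarrow> 'a set \<Rightarrow> bool" where
  "orthogonal_projector Q M \<longleftrightarrow> (\<forall>x. Q x \<in> M \<and> x - Q x \<in> M\<^sup>\<bottom>)"

definition perp_projector :: "('a::real_inner \<Rightarrow> 'a) \<Rightarrow> 'a \<Rightarrow> 'a" where
  "perp_projector Q = (\<lambda>x. x - Q x)"

lemma orthogonal_projector_perp:
  assumes "orthogonal_projector Q M"
  shows "orthogonal_projector (perp_projector Q) (M\<^sup>\<bottom>)"
  using assms
  by (auto simp: orthogonal_projector_def perp_projector_def orthogonal_comp_def orthogonal_def
      inner_commute)

(* All quotients whose infimum is taken below lie in [0,1], and the infimum is meant in that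
   interval: the infimum over no arguments is 1 (cf. Kato's convention for the minimum gap of
   M and N when M is contained in N).  With any other value, such as infinity, the equalities
   between the infima would fail for nested distinct subspaces.
   The real Inf is the proper one for the nonempty case, as the quotients are bounded below. *)
definition inf_quotient :: "'a set \<Rightarrow> ('a \<Rightarrow> real) \<Rightarrow> ('a \<Rightarrow> real) \<Rightarrow> real" where
  "inf_quotient S f g =
    (let R = {f \<psi> / g \<psi> | \<psi>. \<psi> \<in> S \<and> \<not> (f \<psi> = 0 \<and> g \<psi> = 0)}
     in if R = {} then 1 else Inf R)"

definition dist_quotient :: "'a::real_normed_vector set \<Rightarrow> 'a set \<Rightarrow> real" where
  "dist_quotient M N =
    inf_quotient {\<psi>. \<psi> \<in> M \<and> \<psi> \<notin> N} (\<lambda>\<psi>. infdist \<psi> N) (\<lambda>\<psi>. infdist \<psi> (N \<inter> M))"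

definition norm_quotient :: "('a::real_normed_vector \<Rightarrow> 'a) \<Rightarrow> 'a set \<Rightarrow> real" where
  "norm_quotient Q S = inf_quotient S (\<lambda>\<psi>. norm (Q \<psi>)) (\<lambda>\<psi>. norm \<psi>)"

end

theory Submission
  imports Defs
begin

text \<open>Let M and N be closed subspaces with projectors P and Q. Splitting off the component in
  the intersection turns the distance quotient of M and N into the infimum of the norm of \<phi> - Q \<phi>
  over the unit vectors \<phi> of M orthogonal to the intersection. Two dualities between an operator
  and its adjoint then give all the equalities.

  The first is the equality of operator norms. By the theorem of Pythagoras the distance quotient
  is sqrt (1 - s^2) with s the norm of Q between the parts of M and N orthogonal to the
  intersection; the adjoint of that restriction is the corresponding restriction of P, so the
  quotient is symmetric (lemma \<open>dist_quotient_commute\<close>).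

  The second is the equality of reduced minimum moduli: the restriction of P to N, as a map into M,
  and its adjoint, the restriction of Q to M, have the same lower bound on the orthogonal
  complements of their kernels (lemma \<open>norm_quotient_swap\<close>). As the vectors P y with y orthogonal
  to N are dense in the part of M orthogonal to the intersection, each distance quotient is also a
  norm quotient (lemma \<open>dist_quotient_eq_norm_quotient\<close>), and the second duality links the pair of
  subspaces with the pair of their orthogonal complements.

  For the closedness criteria, a map bounded below on a complete space has a closed image, and
  conversely the principle of uniform boundedness produces a lower bound from a closed image
  (lemma \<open>closed_image_iff_norm_quotient_pos\<close>). The sum of two closed subspaces is
  closed exactly when the image of one under the projector onto the orthogonal complement of the
  other is.\<close>

section \<open>Orthogonal projectors in a Hilbert space\<close>

lemma orthogonal_compI: "(\<And>y. y \<in> M \<Longrightarrow> x \<bullet> y = 0) \<Longrightarrow> x \<in> M\<^sup>\<bottom>"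
  by (simp add: orthogonal_comp_def orthogonal_def inner_commute)

lemma orthogonal_compD: "x \<in> M\<^sup>\<bottom> \<Longrightarrow> y \<in> M \<Longrightarrow> x \<bullet> y = 0"
  by (auto simp: orthogonal_comp_def orthogonal_def inner_commute)

lemma closed_orthogonal_comp: "closed ((M :: 'a::real_inner set)\<^sup>\<bottom>)"
proof -
  have "M\<^sup>\<bottom> = (\<Inter>y\<in>M. {x. x \<bullet> y = 0})"
    by (auto intro: orthogonal_compI dest: orthogonal_compD)
  then show ?thesis
    by (auto intro!: closed_INT closed_Collect_eq continuous_intros)
qed

text \<open>If x - m had a large component along y, moving m in the direction y would bring it closer
  to x than the infimum allows; s is the step that minimizes the norm of x - m - s y.\<close>

lemma near_minimizer_near_orthogonal:
  fixes x m :: "'a::real_inner"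
  assumes M: "subspace M" and m: "m \<in> M" and y: "y \<in> M" and \<epsilon>: "\<epsilon> \<ge> 0"
    and near: "(norm (x - m))\<^sup>2 \<le> (infdist x M)\<^sup>2 + \<epsilon>\<^sup>2"
  shows "\<bar>(x - m) \<bullet> y\<bar> \<le> \<epsilon> * norm y"
proof (cases "y = 0")
  case False
  define a where "a = (x - m) \<bullet> y"
  define s where "s = a / (norm y)\<^sup>2"
  have ny: "(norm y)\<^sup>2 > 0" using False by simp
  have "m + s *\<^sub>R y \<in> M" using M m y by (simp add: subspace_add subspace_scale)
  then have "infdist x M \<le> norm (x - (m + s *\<^sub>R y))" by (metis dist_norm infdist_le)
  then have "(infdist x M)\<^sup>2 \<le> (norm (x - (m + s *\<^sub>R y)))\<^sup>2"
    by (simp add: infdist_nonneg power_mono)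
  also have "\<dots> = (norm (x - m))\<^sup>2 - 2 * s * a + s\<^sup>2 * (norm y)\<^sup>2"
    unfolding a_def power2_norm_eq_inner
    by (simp add: algebra_simps inner_commute power2_eq_square)
  also have "\<dots> = (norm (x - m))\<^sup>2 - a\<^sup>2 / (norm y)\<^sup>2"
    using ny by (simp add: s_def field_simps power2_eq_square)
  finally have "a\<^sup>2 / (norm y)\<^sup>2 \<le> \<epsilon>\<^sup>2" using near by linarith
  then have "a\<^sup>2 \<le> (\<epsilon> * norm y)\<^sup>2" using ny by (simp add: field_simps power_mult_distrib)
  then show ?thesis using \<epsilon> by (simp add: a_def abs_le_square_iff[symmetric])
qed simp

text \<open>Projection theorem. For a minimizing sequence, the preceding lemma applied to
  differences of its members gives the Cauchy property, and applied to a fixed vector it gives the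
  orthogonality in the limit.\<close>

theorem orthogonal_projector_exists:
  fixes M :: "'a::{real_inner, complete_space} set"
  assumes M: "subspace M" and cl: "closed M"
  obtains Q where "orthogonal_projector Q M"
proof -
  have "\<exists>l. l \<in> M \<and> x - l \<in> M\<^sup>\<bottom>" for x
  proof -
    have ne: "M \<noteq> {}" using M subspace_0 by blast
    have "\<exists>m\<in>M. (norm (x - m))\<^sup>2 \<le> (infdist x M)\<^sup>2 + \<epsilon>\<^sup>2" if "\<epsilon> > 0" for \<epsilon> :: real
    proof -
      have "infdist x M < sqrt ((infdist x M)\<^sup>2 + \<epsilon>\<^sup>2)"
        using that by (intro real_less_rsqrt) simp
      then obtain m where m: "m \<in> M" "dist x m < sqrt ((infdist x M)\<^sup>2 + \<epsilon>\<^sup>2)"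
        using ne by (auto simp: infdist_def cINF_less_iff)
      have "(dist x m)\<^sup>2 \<le> (sqrt ((infdist x M)\<^sup>2 + \<epsilon>\<^sup>2))\<^sup>2"
        using m by (intro power_mono) auto
      then show ?thesis using m(1) by (auto simp: dist_norm)
    qed
    then have "\<forall>n. \<exists>m\<in>M. (norm (x - m))\<^sup>2 \<le> (infdist x M)\<^sup>2 + (1 / Suc n)\<^sup>2"
      by simp
    then obtain m where mM: "\<And>n. m n \<in> M"
      and near: "\<And>n. (norm (x - m n))\<^sup>2 \<le> (infdist x M)\<^sup>2 + (1 / Suc n)\<^sup>2"
      by metis
    have orth: "\<bar>(x - m n) \<bullet> y\<bar> \<le> 1 / Suc n * norm y" if "y \<in> M" for n y
      by (rule near_minimizer_near_orthogonal[OF M mM that _ near]) simp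
    have close: "norm (m n - m k) \<le> 1 / Suc n + 1 / Suc k" for n k
    proof (cases "m n = m k")
      case False
      have y: "m n - m k \<in> M" using M mM subspace_diff by blast
      have "norm (m n - m k) * norm (m n - m k)
          = (x - m k) \<bullet> (m n - m k) - (x - m n) \<bullet> (m n - m k)"
        by (simp add: power2_norm_eq_inner[unfolded power2_eq_square] inner_diff_left)
      also have "\<dots> \<le> (1 / Suc n + 1 / Suc k) * norm (m n - m k)"
        using orth[OF y, of n] orth[OF y, of k] by (simp add: algebra_simps)
      finally show ?thesis using False by simp
    qed simp
    have "Cauchy m"
    proof (rule metric_CauchyI)
      fix e :: real assume "e > 0"
      then obtain N where N: "1 / Suc N < e / 2"
        by (meson half_gt_zero nat_approx_posE)
      have "dist (m n) (m k) < e" if "n \<ge> N" "k \<ge> N" for n k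
      proof -
        have "1 / real (Suc n) \<le> 1 / Suc N" "1 / real (Suc k) \<le> 1 / Suc N"
          using that by (simp_all add: frac_le)
        then show ?thesis using close[of n k] N by (simp add: dist_norm)
      qed
      then show "\<exists>N. \<forall>n\<ge>N. \<forall>k\<ge>N. dist (m n) (m k) < e" by blast
    qed
    then obtain l where l: "m \<longlonglongrightarrow> l" using Cauchy_convergent convergent_def by blast
    have "l \<in> M" using cl l mM closed_sequentially by blast
    moreover have "(x - l) \<bullet> y = 0" if y: "y \<in> M" for y
    proof -
      have "(\<lambda>n. (x - m n) \<bullet> y) \<longlonglongrightarrow> (x - l) \<bullet> y" by (intro tendsto_intros l)
      moreover have "(\<lambda>n. (x - m n) \<bullet> y) \<longlonglongrightarrow> 0"
      proof (rule Lim_null_comparison)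
        show "\<forall>\<^sub>F n in sequentially. norm ((x - m n) \<bullet> y) \<le> 1 / Suc n * norm y"
          using orth[OF y] by simp
        show "(\<lambda>n. 1 / Suc n * norm y) \<longlonglongrightarrow> 0"
          using tendsto_mult_left_zero[OF LIMSEQ_inverse_real_of_nat, of "norm y"]
          by (simp add: inverse_eq_divide)
      qed
      ultimately show ?thesis using LIMSEQ_unique by blast
    qed
    ultimately show ?thesis by (blast intro: orthogonal_compI)
  qed
  then obtain Q where "\<And>x. Q x \<in> M \<and> x - Q x \<in> M\<^sup>\<bottom>" by metis
  then show thesis using that[of Q] by (simp add: orthogonal_projector_def)
qed

locale projector =
  fixes Q :: "'a::real_inner \<Rightarrow> 'a" and M :: "'a set"
  assumes subspace: "subspace M" and proj: "orthogonal_projector Q M"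
begin

lemma range_in: "Q x \<in> M"
  and residual_in: "x - Q x \<in> M\<^sup>\<bottom>"
  using proj by (auto simp: orthogonal_projector_def)

lemma inner_residual: "y \<in> M \<Longrightarrow> (x - Q x) \<bullet> y = 0"
  using residual_in orthogonal_compD by blast

lemma inner_proj: "y \<in> M \<Longrightarrow> Q x \<bullet> y = x \<bullet> y"
  using inner_residual[of y x] by (simp add: inner_diff_left)

lemma eqI:
  assumes "y \<in> M" and "\<And>z. z \<in> M \<Longrightarrow> (x - y) \<bullet> z = 0"
  shows "Q x = y"
proof -
  have "Q x - y \<in> M" by (simp add: assms(1) range_in subspace subspace_diff)
  then have "(Q x - y) \<bullet> (Q x - y) = 0"
    using assms(2)[of "Q x - y"] inner_residual[of "Q x - y" x] by (simp add: inner_diff_left)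
  then show ?thesis by simp
qed

lemma fixed: "x \<in> M \<Longrightarrow> Q x = x"
  by (simp add: eqI)

lemma zero_on_perp: "x \<in> M\<^sup>\<bottom> \<Longrightarrow> Q x = 0"
  by (auto intro!: eqI subspace_0 subspace dest: orthogonal_compD)

lemma self_adjoint: "Q x \<bullet> y = x \<bullet> Q y"
  by (metis inner_commute inner_proj range_in)

lemma linear: "linear Q"
proof (rule linearI)
  show "Q (x + y) = Q x + Q y" for x y
    by (rule eqI) (simp_all add: range_in subspace subspace_add inner_proj algebra_simps)
  show "Q (c *\<^sub>R x) = c *\<^sub>R Q x" for c x
    by (rule eqI) (simp_all add: range_in subspace subspace_scale inner_proj algebra_simps)
qed

lemma norm_pythagoras: "(norm x)\<^sup>2 = (norm (Q x))\<^sup>2 + (norm (x - Q x))\<^sup>2"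
proof -
  have "Q x \<bullet> Q x = x \<bullet> Q x" using inner_proj range_in by blast
  then show ?thesis by (simp add: power2_norm_eq_inner algebra_simps inner_commute)
qed

lemma norm_le: "norm (Q x) \<le> norm x"
  using norm_pythagoras[of x] by (auto intro: power2_le_imp_le)

lemma bounded_linear: "bounded_linear Q"
  using linear norm_le by (intro bounded_linear_intro[where K = 1]) (auto simp: linear_add linear_cmul)

lemma infdist_eq: "infdist x M = norm (x - Q x)"
proof (rule antisym)
  show "infdist x M \<le> norm (x - Q x)" by (metis dist_norm infdist_le range_in)
  have ne: "M \<noteq> {}" using range_in by blast
  show "norm (x - Q x) \<le> infdist x M"
    unfolding infdist_notempty[OF ne]
  proof (rule cINF_greatest[OF ne])
    fix y assume "y \<in> M"
    then have "(x - y) - Q (x - y) = x - Q x" by (simp add: linear_diff[OF linear] fixed)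
    then have "(norm (x - Q x))\<^sup>2 \<le> (norm (x - y))\<^sup>2"
      by (metis norm_pythagoras[of "x - y"] le_add_same_cancel2 zero_le_power2)
    then show "norm (x - Q x) \<le> dist x y" by (simp add: dist_norm)
  qed
qed

lemma perp_perp: "M\<^sup>\<bottom>\<^sup>\<bottom> = M"
proof
  show "M\<^sup>\<bottom>\<^sup>\<bottom> \<subseteq> M"
  proof
    fix x assume x: "x \<in> M\<^sup>\<bottom>\<^sup>\<bottom>"
    have "(x - Q x) \<bullet> x = 0"
      using orthogonal_compD[OF x residual_in[of x]] by (simp add: inner_commute)
    then have "(x - Q x) \<bullet> (x - Q x) = 0"
      using inner_residual[OF range_in] by (simp add: inner_diff_right)
    then have "x = Q x" by simp
    then show "x \<in> M" by (metis range_in)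
  qed
qed (rule orthogonal_comp_subset)

lemma closed: "closed M"
  using closed_orthogonal_comp perp_perp by metis

lemma projector_perp: "projector (perp_projector Q) (M\<^sup>\<bottom>)"
  by unfold_locales (auto simp: subspace_orthogonal_comp orthogonal_projector_perp proj)

lemma perp_perp_projector: "perp_projector (perp_projector Q) = Q"
  by (simp add: perp_projector_def)

lemma perp_projector_eq_0_iff: "perp_projector Q x = 0 \<longleftrightarrow> x \<in> M"
  by (metis fixed perp_projector_def range_in eq_iff_diff_eq_0)

end

lemma projector_exists:
  fixes M :: "'a::{real_inner, complete_space} set"
  assumes "subspace M" and "closed M"
  obtains Q where "projector Q M"
  using assms orthogonal_projector_exists projector.intro by metis

lemma subspace_closure:
  fixes S :: "'a::real_normed_vector set"
  assumes S: "subspace S"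
  shows "subspace (closure S)"
proof (rule subspaceI)
  show "0 \<in> closure S" using S subspace_0 closure_subset by blast
  fix x y assume "x \<in> closure S" "y \<in> closure S"
  then obtain u v where "\<And>n. u n \<in> S" "u \<longlonglongrightarrow> x" "\<And>n. v n \<in> S" "v \<longlonglongrightarrow> y"
    unfolding closure_sequential by blast
  then show "x + y \<in> closure S"
    unfolding closure_sequential
    by (intro exI[of _ "\<lambda>n. u n + v n"]) (auto intro: tendsto_intros subspace_add[OF S])
next
  fix x and c :: real assume "x \<in> closure S"
  then obtain u where "\<And>n. u n \<in> S" "u \<longlonglongrightarrow> x"
    unfolding closure_sequential by blast
  then show "c *\<^sub>R x \<in> closure S"
    unfolding closure_sequential
    by (intro exI[of _ "\<lambda>n. c *\<^sub>R u n"]) (auto intro: tendsto_intros subspace_scale[OF S])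
qed

text \<open>Membership in the closure of a subspace becomes an orthogonality statement. All density
  arguments below go through this identity.\<close>

lemma orthogonal_comp_comp_eq_closure:
  fixes S :: "'a::{real_inner, complete_space} set"
  assumes "subspace S"
  shows "S\<^sup>\<bottom>\<^sup>\<bottom> = closure S"
proof
  show "closure S \<subseteq> S\<^sup>\<bottom>\<^sup>\<bottom>"
    by (simp add: closed_orthogonal_comp closure_minimal orthogonal_comp_subset)
  obtain C where "projector C (closure S)"
    using projector_exists assms by (metis closed_closure subspace_closure)
  then have "closure S = (closure S)\<^sup>\<bottom>\<^sup>\<bottom>" by (simp add: projector.perp_perp)
  moreover have "S\<^sup>\<bottom>\<^sup>\<bottom> \<subseteq> (closure S)\<^sup>\<bottom>\<^sup>\<bottom>"
    by (simp add: closure_subset orthogonal_comp_anti_mono)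
  ultimately show "S\<^sup>\<bottom>\<^sup>\<bottom> \<subseteq> closure S" by simp
qed

lemma norm_lower_bound_closure:
  fixes f :: "'a::real_normed_vector \<Rightarrow> 'b::real_normed_vector"
  assumes f: "bounded_linear f"
    and bound: "\<And>x. x \<in> S \<Longrightarrow> t * norm x \<le> norm (f x)"
    and x: "x \<in> closure S"
  shows "t * norm x \<le> norm (f x)"
proof -
  have "closed {x. t * norm x \<le> norm (f x)}"
    by (intro closed_Collect_le continuous_intros linear_continuous_on f)
  then have "closure S \<subseteq> {x. t * norm x \<le> norm (f x)}"
    using bound by (intro closure_minimal) auto
  with x show ?thesis by blast
qed

section \<open>Infima of quotients\<close>

lemma quotients_subset_unit_interval:
  fixes f g :: "'a \<Rightarrow> real"
  assumes f: "\<And>x. x \<in> S \<Longrightarrow> 0 \<le> f x" and fg: "\<And>x. x \<in> S \<Longrightarrow> f x \<le> g x"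
  shows "{f x / g x | x. x \<in> S \<and> \<not> (f x = 0 \<and> g x = 0)} \<subseteq> {0..1}"
proof clarify
  fix x assume x: "x \<in> S"
  then show "f x / g x \<in> {0..1}"
    using f[OF x] fg[OF x] by (cases "g x = 0") auto
qed

text \<open>An infimum of quotients with values in [0, 1] is determined by its lower bounds in that
  interval; passing to these bounds removes all divisions, and the infimum 1 over no arguments
  fits in because then every t \<le> 1 is a bound.\<close>

lemma le_inf_quotient_iff:
  assumes f: "\<And>x. x \<in> S \<Longrightarrow> 0 \<le> f x" and fg: "\<And>x. x \<in> S \<Longrightarrow> f x \<le> g x" and "t \<le> 1"
  shows "t \<le> inf_quotient S f g \<longleftrightarrow> (\<forall>x\<in>S. t * g x \<le> f x)"
proof -
  define R where "R = {f x / g x | x. x \<in> S \<and> \<not> (f x = 0 \<and> g x = 0)}"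
  have eq: "inf_quotient S f g = (if R = {} then 1 else Inf R)"
    unfolding inf_quotient_def Let_def R_def by (rule refl)
  have "R \<subseteq> {0..1}"
    unfolding R_def using f fg by (rule quotients_subset_unit_interval)
  then have "bdd_below R" by (rule bdd_below_mono[OF bdd_below_Icc])
  then have "t \<le> inf_quotient S f g \<longleftrightarrow> (\<forall>r\<in>R. t \<le> r)"
    using \<open>t \<le> 1\<close> by (simp add: eq le_cInf_iff)
  also have "\<dots> \<longleftrightarrow> (\<forall>x\<in>S. \<not> (f x = 0 \<and> g x = 0) \<longrightarrow> t \<le> f x / g x)"
    by (auto simp: R_def)
  also have "\<dots> \<longleftrightarrow> (\<forall>x\<in>S. t * g x \<le> f x)"
  proof (rule ball_cong[OF refl])
    fix x assume x: "x \<in> S"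
    show "(\<not> (f x = 0 \<and> g x = 0) \<longrightarrow> t \<le> f x / g x) \<longleftrightarrow> t * g x \<le> f x"
    proof (cases "g x = 0")
      case True then show ?thesis using f[OF x] fg[OF x] by auto
    next
      case False then have "g x > 0" using f[OF x] fg[OF x] by linarith
      then show ?thesis by (simp add: field_simps)
    qed
  qed
  finally show ?thesis .
qed

lemma inf_quotient_le_1:
  assumes f: "\<And>x. x \<in> S \<Longrightarrow> 0 \<le> f x" and fg: "\<And>x. x \<in> S \<Longrightarrow> f x \<le> g x"
  shows "inf_quotient S f g \<le> 1"
proof -
  define R where "R = {f x / g x | x. x \<in> S \<and> \<not> (f x = 0 \<and> g x = 0)}"
  have eq: "inf_quotient S f g = (if R = {} then 1 else Inf R)"
    unfolding inf_quotient_def Let_def R_def by (rule refl)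
  have R: "R \<subseteq> {0..1}"
    unfolding R_def using f fg by (rule quotients_subset_unit_interval)
  have "Inf R \<le> 1" if "r \<in> R" for r
    using cInf_lower[OF that bdd_below_mono[OF bdd_below_Icc R]] R that by fastforce
  then show ?thesis by (auto simp: eq)
qed

lemma eq_by_lower_bounds:
  fixes a b :: real
  assumes "0 \<le> a" "a \<le> 1" "0 \<le> b" "b \<le> 1"
    and "\<And>t. 0 < t \<Longrightarrow> t \<le> 1 \<Longrightarrow> t \<le> a \<longleftrightarrow> t \<le> b"
  shows "a = b"
  using assms(5)[of a] assms(5)[of b] assms(1-4) by linarith

lemma norm_quotient_bounds:
  assumes "projector Q M"
  shows "0 \<le> norm_quotient Q S" "norm_quotient Q S \<le> 1"
    and le_norm_quotient_iff:
      "t \<le> 1 \<Longrightarrow> t \<le> norm_quotient Q S \<longleftrightarrow> (\<forall>\<psi>\<in>S. t * norm \<psi> \<le> norm (Q \<psi>))"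
proof -
  note q = projector.norm_le[OF assms]
  show iff: "t \<le> norm_quotient Q S \<longleftrightarrow> (\<forall>\<psi>\<in>S. t * norm \<psi> \<le> norm (Q \<psi>))" if "t \<le> 1" for t
    unfolding norm_quotient_def using q that by (intro le_inf_quotient_iff) auto
  show "0 \<le> norm_quotient Q S" using iff[of 0] by simp
  show "norm_quotient Q S \<le> 1"
    unfolding norm_quotient_def using q by (intro inf_quotient_le_1) auto
qed

text \<open>Subtracting from an element of M its component in the intersection does not change its
  distances to N and to the intersection. So the infimum may be taken over the elements of M
  orthogonal to the intersection, for which the denominator is just the norm.\<close>

lemma dist_quotient_bounds:
  fixes M N :: "'a::{real_inner, complete_space} set"
  assumes "projector P M" and "projector Q N"
  shows "0 \<le> dist_quotient M N" "dist_quotient M N \<le> 1"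
    and le_dist_quotient_iff:
      "t \<le> 1 \<Longrightarrow> t \<le> dist_quotient M N
        \<longleftrightarrow> (\<forall>\<phi>\<in>M \<inter> (M \<inter> N)\<^sup>\<bottom>. t * norm \<phi> \<le> norm (perp_projector Q \<phi>))"
proof -
  interpret P: projector P M by fact
  interpret Q: projector Q N by fact
  obtain K where "projector K (M \<inter> N)"
    using projector_exists P.subspace Q.subspace P.closed Q.closed
    by (metis closed_Int subspace_inter)
  then interpret K: projector K "M \<inter> N" .
  have le: "infdist \<psi> N \<le> infdist \<psi> (N \<inter> M)" for \<psi>
    using K.range_in by (intro infdist_mono) auto
  show "0 \<le> dist_quotient M N"
    unfolding dist_quotient_def
    by (subst le_inf_quotient_iff) (auto simp: infdist_nonneg le)
  show "dist_quotient M N \<le> 1"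
    unfolding dist_quotient_def by (intro inf_quotient_le_1) (auto simp: infdist_nonneg le)
  assume t: "t \<le> 1"
  have "t \<le> dist_quotient M N
      \<longleftrightarrow> (\<forall>\<psi>\<in>{\<psi>. \<psi> \<in> M \<and> \<psi> \<notin> N}. t * infdist \<psi> (N \<inter> M) \<le> infdist \<psi> N)"
    unfolding dist_quotient_def using t
    by (intro le_inf_quotient_iff) (auto simp: infdist_nonneg le)
  also have "\<dots> \<longleftrightarrow> (\<forall>\<psi>\<in>M. t * infdist \<psi> (N \<inter> M) \<le> infdist \<psi> N)"
    by auto
  also have "\<dots> \<longleftrightarrow> (\<forall>\<psi>\<in>M. t * norm (\<psi> - K \<psi>) \<le> norm (perp_projector Q \<psi>))"
    by (simp add: Int_commute[of N M] K.infdist_eq Q.infdist_eq perp_projector_def)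
  also have "\<dots> \<longleftrightarrow> (\<forall>\<phi>\<in>M \<inter> (M \<inter> N)\<^sup>\<bottom>. t * norm \<phi> \<le> norm (perp_projector Q \<phi>))"
  proof (intro iffI ballI)
    fix \<phi> assume all: "\<forall>\<psi>\<in>M. t * norm (\<psi> - K \<psi>) \<le> norm (perp_projector Q \<psi>)"
      and \<phi>: "\<phi> \<in> M \<inter> (M \<inter> N)\<^sup>\<bottom>"
    then show "t * norm \<phi> \<le> norm (perp_projector Q \<phi>)"
      using all[rule_format, of \<phi>] K.zero_on_perp[of \<phi>] by simp
  next
    fix \<psi> assume all: "\<forall>\<phi>\<in>M \<inter> (M \<inter> N)\<^sup>\<bottom>. t * norm \<phi> \<le> norm (perp_projector Q \<phi>)"
      and \<psi>: "\<psi> \<in> M"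
    have "\<psi> - K \<psi> \<in> M \<inter> (M \<inter> N)\<^sup>\<bottom>"
      using \<psi> K.range_in[of \<psi>] K.residual_in P.subspace by (auto intro: subspace_diff)
    moreover have "perp_projector Q (\<psi> - K \<psi>) = perp_projector Q \<psi>"
      using Q.fixed[of "K \<psi>"] K.range_in[of \<psi>]
      by (simp add: perp_projector_def linear_diff[OF Q.linear])
    ultimately show "t * norm (\<psi> - K \<psi>) \<le> norm (perp_projector Q \<psi>)"
      using all by metis
  qed
  finally show "t \<le> dist_quotient M N
        \<longleftrightarrow> (\<forall>\<phi>\<in>M \<inter> (M \<inter> N)\<^sup>\<bottom>. t * norm \<phi> \<le> norm (perp_projector Q \<phi>))" .
qed

section \<open>Equality of the eight infima\<close>

lemma proj_in_perp_inter:
  assumes "projector P M" and y: "y \<in> (M \<inter> N)\<^sup>\<bottom>"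
  shows "P y \<in> M \<inter> (M \<inter> N)\<^sup>\<bottom>"
proof -
  interpret projector P M by fact
  show ?thesis using y by (auto simp: range_in inner_proj intro!: orthogonal_compI dest: orthogonal_compD)
qed

text \<open>The vectors P y with y orthogonal to N are dense in the part of M orthogonal to the
  intersection: if z is orthogonal to all of them, then P z lies in N and hence in the
  intersection.\<close>

lemma closure_proj_image_perp:
  fixes M N :: "'a::{real_inner, complete_space} set"
  assumes "projector P M" and "projector Q N"
  shows "M \<inter> (M \<inter> N)\<^sup>\<bottom> \<subseteq> closure (P ` (N\<^sup>\<bottom>))"
proof
  interpret P: projector P M by fact
  interpret Q: projector Q N by fact
  fix \<phi> assume \<phi>: "\<phi> \<in> M \<inter> (M \<inter> N)\<^sup>\<bottom>"
  have "\<phi> \<in> (P ` (N\<^sup>\<bottom>))\<^sup>\<bottom>\<^sup>\<bottom>"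
  proof (rule orthogonal_compI)
    fix z assume z: "z \<in> (P ` (N\<^sup>\<bottom>))\<^sup>\<bottom>"
    have "P z \<in> N\<^sup>\<bottom>\<^sup>\<bottom>"
      using orthogonal_compD[OF z] by (auto intro!: orthogonal_compI simp: P.self_adjoint)
    then have "P z \<in> M \<inter> N" by (simp add: P.range_in Q.perp_perp)
    then have "\<phi> \<bullet> P z = 0" using \<phi> orthogonal_compD by blast
    then show "\<phi> \<bullet> z = 0" using \<phi> P.fixed P.self_adjoint by (metis IntD1)
  qed
  then show "\<phi> \<in> closure (P ` (N\<^sup>\<bottom>))"
    by (simp add: orthogonal_comp_comp_eq_closure P.linear linear_subspace_image
        subspace_orthogonal_comp)
qed

lemma dist_quotient_eq_norm_quotient:
  fixes M N :: "'a::{real_inner, complete_space} set"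
  assumes P: "projector P M" and Q: "projector Q N"
  shows "dist_quotient M N = norm_quotient (perp_projector Q) (P ` (N\<^sup>\<bottom>))"
proof (rule eq_by_lower_bounds)
  note Q' = projector.projector_perp[OF Q]
  show "0 \<le> dist_quotient M N" "dist_quotient M N \<le> 1"
    using dist_quotient_bounds[OF P Q] by auto
  show "0 \<le> norm_quotient (perp_projector Q) (P ` (N\<^sup>\<bottom>))"
    "norm_quotient (perp_projector Q) (P ` (N\<^sup>\<bottom>)) \<le> 1"
    using norm_quotient_bounds[OF Q'] by auto
  fix t :: real assume t: "t \<le> 1"
  have sub: "P ` (N\<^sup>\<bottom>) \<subseteq> M \<inter> (M \<inter> N)\<^sup>\<bottom>"
    using proj_in_perp_inter[OF P] orthogonal_comp_anti_mono[of "M \<inter> N" N] by blast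
  show "t \<le> dist_quotient M N \<longleftrightarrow> t \<le> norm_quotient (perp_projector Q) (P ` (N\<^sup>\<bottom>))"
    unfolding le_dist_quotient_iff[OF P Q t] le_norm_quotient_iff[OF Q' t]
    using sub closure_proj_image_perp[OF P Q]
      norm_lower_bound_closure[OF projector.bounded_linear[OF Q'], of "P ` (N\<^sup>\<bottom>)" t]
    by blast
qed

text \<open>Write T for the restriction of P to N as a map into M. Its adjoint is the restriction of Q
  to M. A lower bound t for the adjoint on the range of T gives, by the Cauchy-Schwarz inequality,
  the same bound for T on the vectors u = Q (P z), which are dense in the range of the adjoint.\<close>

lemma lower_bound_adjoint:
  fixes M N :: "'a::{real_inner, complete_space} set"
  assumes "projector P M" and "projector Q N" and "t > 0"
    and bound: "\<And>z. z \<in> N \<Longrightarrow> t * norm (P z) \<le> norm (Q (P z))"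
    and x: "x \<in> M"
  shows "t * norm (Q x) \<le> norm (P (Q x))"
proof -
  interpret P: projector P M by fact
  interpret Q: projector Q N by fact
  let ?S = "(\<lambda>z. Q (P z)) ` N"
  have "subspace ?S"
    using linear_subspace_image[OF linear_compose[OF P.linear Q.linear] Q.subspace]
    by (simp add: o_def)
  moreover have "Q x \<in> ?S\<^sup>\<bottom>\<^sup>\<bottom>"
  proof (rule orthogonal_compI)
    fix w assume w: "w \<in> ?S\<^sup>\<bottom>"
    have "w \<bullet> Q (P (Q w)) = 0"
      using w Q.range_in by (blast dest: orthogonal_compD)
    then have "P (Q w) \<bullet> P (Q w) = 0"
      by (metis P.inner_proj P.range_in Q.self_adjoint)
    then have "P (Q w) = 0" by simp
    then show "Q x \<bullet> w = 0"
      by (metis P.fixed P.self_adjoint Q.self_adjoint inner_zero_right x)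
  qed
  ultimately have "Q x \<in> closure ?S" by (simp add: orthogonal_comp_comp_eq_closure)
  moreover have "t * norm u \<le> norm (P u)" if "u \<in> ?S" for u
  proof (cases "u = 0")
    case False
    obtain z where z: "z \<in> N" "u = Q (P z)" using \<open>u \<in> ?S\<close> by blast
    have "norm u * norm u = Q (P z) \<bullet> u"
      by (simp add: z(2) flip: power2_eq_square power2_norm_eq_inner)
    also have "\<dots> = P z \<bullet> u" by (rule Q.inner_proj) (simp add: z(2) Q.range_in)
    also have "\<dots> = P z \<bullet> P u"
      using P.self_adjoint[of "P z" u] by (simp add: P.fixed P.range_in)
    also have "\<dots> \<le> norm (P z) * norm (P u)" by (rule norm_cauchy_schwarz)
    finally have "t * (norm u * norm u) \<le> (t * norm (P z)) * norm (P u)"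
      using \<open>t > 0\<close> by (simp add: mult.assoc)
    also have "\<dots> \<le> norm u * norm (P u)"
      using bound[OF z(1)] z(2) by (simp add: mult_right_mono)
    finally show ?thesis using False by (simp add: mult.left_commute)
  qed (simp add: linear_0[OF P.linear])
  ultimately show ?thesis
    using norm_lower_bound_closure[OF P.bounded_linear] by blast
qed

lemma norm_quotient_swap:
  fixes M N :: "'a::{real_inner, complete_space} set"
  assumes P: "projector P M" and Q: "projector Q N"
  shows "norm_quotient Q (P ` N) = norm_quotient P (Q ` M)"
proof (rule eq_by_lower_bounds)
  show "0 \<le> norm_quotient Q (P ` N)" "norm_quotient Q (P ` N) \<le> 1"
    using norm_quotient_bounds[OF Q] by auto
  show "0 \<le> norm_quotient P (Q ` M)" "norm_quotient P (Q ` M) \<le> 1"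
    using norm_quotient_bounds[OF P] by auto
  fix t :: real assume t: "0 < t" "t \<le> 1"
  show "t \<le> norm_quotient Q (P ` N) \<longleftrightarrow> t \<le> norm_quotient P (Q ` M)"
    unfolding le_norm_quotient_iff[OF P t(2)] le_norm_quotient_iff[OF Q t(2)]
    using lower_bound_adjoint[OF P Q t(1)] lower_bound_adjoint[OF Q P t(1)] by blast
qed

text \<open>By the theorem of Pythagoras, 0 < t \<le> 1 is a lower bound for the quotient exactly when
  sqrt (1 - t^2) bounds the norm of Q on the part of M orthogonal to the intersection. The adjoint
  of this restriction of Q is the restriction of P to the corresponding part of N, and a map and
  its adjoint have the same norm.\<close>

lemma dist_lower_bound_commute:
  fixes M N :: "'a::real_inner set"
  assumes "projector P M" and "projector Q N" and t: "0 < t" "t \<le> 1"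
    and bound: "\<And>\<phi>. \<phi> \<in> M \<inter> (M \<inter> N)\<^sup>\<bottom> \<Longrightarrow> t * norm \<phi> \<le> norm (perp_projector Q \<phi>)"
    and y: "y \<in> N \<inter> (M \<inter> N)\<^sup>\<bottom>"
  shows "t * norm y \<le> norm (perp_projector P y)"
proof -
  interpret P: projector P M by fact
  interpret Q: projector Q N by fact
  define x where "x = P y"
  have "x \<in> M \<inter> (M \<inter> N)\<^sup>\<bottom>"
    using proj_in_perp_inter[OF \<open>projector P M\<close>, of y N] y by (simp add: x_def)
  then have "(t * norm x)\<^sup>2 \<le> (norm (x - Q x))\<^sup>2"
    using bound[of x] t(1) by (intro power_mono) (auto simp: perp_projector_def)
  then have Qx: "(norm (Q x))\<^sup>2 \<le> (1 - t\<^sup>2) * (norm x)\<^sup>2"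
    using Q.norm_pythagoras[of x] by (simp add: algebra_simps power_mult_distrib)
  have xx: "x \<bullet> x = Q x \<bullet> y"
    using y P.inner_proj[OF P.range_in, of y y] Q.inner_proj[of y x]
    by (simp add: x_def inner_commute)
  have "(norm x)\<^sup>2 \<le> (1 - t\<^sup>2) * (norm y)\<^sup>2"
  proof (cases "x = 0")
    case False
    have "(norm x)\<^sup>2 \<le> norm (Q x) * norm y"
      unfolding power2_norm_eq_inner xx by (rule norm_cauchy_schwarz)
    then have "((norm x)\<^sup>2)\<^sup>2 \<le> (norm (Q x) * norm y)\<^sup>2" by (rule power_mono) simp
    also have "\<dots> = (norm (Q x))\<^sup>2 * (norm y)\<^sup>2" by (rule power_mult_distrib)
    also have "\<dots> \<le> (1 - t\<^sup>2) * (norm x)\<^sup>2 * (norm y)\<^sup>2"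
      using Qx by (rule mult_right_mono) simp
    finally have "(norm x)\<^sup>2 * (norm x)\<^sup>2 \<le> (norm x)\<^sup>2 * ((1 - t\<^sup>2) * (norm y)\<^sup>2)"
      by (simp add: power2_eq_square mult_ac)
    then show ?thesis by (rule mult_left_le_imp_le) (use False in simp)
  next
    case True
    moreover have "t\<^sup>2 \<le> 1" using t by (simp add: power_le_one)
    ultimately show ?thesis by simp
  qed
  then have "(t * norm y)\<^sup>2 \<le> (norm (y - P y))\<^sup>2"
    using P.norm_pythagoras[of y] by (simp add: x_def algebra_simps power_mult_distrib)
  then have "t * norm y \<le> norm (y - P y)" by (rule power2_le_imp_le) simp
  then show ?thesis by (simp add: perp_projector_def)
qed

lemma dist_quotient_commute:
  fixes M N :: "'a::{real_inner, complete_space} set"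
  assumes P: "projector P M" and Q: "projector Q N"
  shows "dist_quotient M N = dist_quotient N M"
proof (rule eq_by_lower_bounds)
  show "0 \<le> dist_quotient M N" "dist_quotient M N \<le> 1"
    using dist_quotient_bounds[OF P Q] by auto
  show "0 \<le> dist_quotient N M" "dist_quotient N M \<le> 1"
    using dist_quotient_bounds[OF Q P] by auto
  fix t :: real assume t: "0 < t" "t \<le> 1"
  show "t \<le> dist_quotient M N \<longleftrightarrow> t \<le> dist_quotient N M"
    unfolding le_dist_quotient_iff[OF P Q t(2)] le_dist_quotient_iff[OF Q P t(2)]
    using dist_lower_bound_commute[OF P Q t] dist_lower_bound_commute[OF Q P t]
    by (auto simp: Int_commute[of N M])
qed

section \<open>Closed ranges\<close>

text \<open>The principle of uniform boundedness for the functionals given by inner products with the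
  elements of F: by Baire's theorem one of the closed sets A k of vectors on which all these
  functionals are bounded by k contains a ball.\<close>

lemma weakly_bounded_imp_bounded:
  fixes F :: "'a::{real_inner, complete_space} set"
  assumes weak: "\<And>h. \<exists>c. \<forall>y\<in>F. \<bar>y \<bullet> h\<bar> \<le> c"
  obtains C where "C > 0" and "\<And>y. y \<in> F \<Longrightarrow> norm y \<le> C"
proof -
  define A where "A k = {h. \<forall>y\<in>F. \<bar>y \<bullet> h\<bar> \<le> real k}" for k :: nat
  have cl: "closed (A k)" for k
  proof -
    have "A k = (\<Inter>y\<in>F. {h. \<bar>y \<bullet> h\<bar> \<le> real k})" by (auto simp: A_def)
    then show ?thesis by (auto intro!: closed_INT closed_Collect_le continuous_intros)
  qed
  have "\<exists>k. h \<in> A k" for h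
  proof -
    obtain c where "\<forall>y\<in>F. \<bar>y \<bullet> h\<bar> \<le> c" using weak by blast
    moreover obtain k :: nat where "c \<le> real k" using real_arch_simple by blast
    ultimately have "h \<in> A k" by (fastforce simp: A_def)
    then show ?thesis by blast
  qed
  then have cover: "\<Union>(range A) = UNIV" by auto
  obtain k where "interior (A k) \<noteq> {}"
  proof (rule ccontr)
    assume "\<not> thesis"
    then have "euclidean interior_of \<Union>(range A) = {}"
      using cl that by (intro Baire_category_alt) (auto simp: completely_metrizable_space_euclidean)
    then show False by (simp add: cover)
  qed
  then obtain h r where r: "r > 0" and ball: "cball h r \<subseteq> A k"
    by (meson ex_in_conv mem_interior_cball)
  have bound: "norm y \<le> 2 * k / r" if y: "y \<in> F" for y
  proof (cases "y = 0")
    case False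
    define u where "u = (r / norm y) *\<^sub>R y"
    have "norm u = r" using False r by (simp add: u_def)
    then have "h \<in> A k" "h + u \<in> A k" using ball r by (auto simp: dist_norm)
    then have "\<bar>y \<bullet> h\<bar> \<le> k" "\<bar>y \<bullet> (h + u)\<bar> \<le> k" using y by (auto simp: A_def)
    then have "y \<bullet> u \<le> 2 * k" by (simp add: inner_add_right)
    moreover have "y \<bullet> u = r * norm y"
      using False by (simp add: u_def dot_square_norm power2_eq_square)
    ultimately show ?thesis using r by (simp add: field_simps)
  qed (use r in simp)
  show thesis
  proof (rule that)
    show "2 * k / r + 1 > 0" using r by (simp add: add_nonneg_pos)
  qed (use bound in force)
qed

text \<open>Only the closure W of the range of Q on M matters for the range of P on N, since P
  vanishes on the part of N orthogonal to W. On W the map P is bounded below when the quotient is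
  positive, so the image of the complete space W is complete.\<close>

lemma closed_image_if_norm_quotient_pos:
  fixes M N :: "'a::{real_inner, complete_space} set"
  assumes P: "projector P M" and Q: "projector Q N"
    and pos: "norm_quotient Q (P ` N) > 0"
  shows "closed (P ` N)"
proof -
  interpret P: projector P M by fact
  interpret Q: projector Q N by fact
  define t where "t = norm_quotient Q (P ` N)"
  define W where "W = closure (Q ` M)"
  have t: "t > 0" "t \<le> 1" using pos norm_quotient_bounds[OF Q] by (simp_all add: t_def)
  have "t \<le> norm_quotient P (Q ` M)" by (simp add: t_def norm_quotient_swap[OF P Q])
  then have "t * norm w \<le> norm (P w)" if "w \<in> W" for w
    using norm_lower_bound_closure[OF P.bounded_linear] le_norm_quotient_iff[OF P t(2)] that
    unfolding W_def by blast
  moreover have W: "subspace W"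
    unfolding W_def by (intro subspace_closure linear_subspace_image Q.linear P.subspace)
  moreover have "complete W" by (simp add: W_def complete_eq_closed)
  ultimately have "complete (P ` W)"
    using complete_isometric_image[OF t(1) _ P.bounded_linear] by blast
  moreover have "P ` W = P ` N"
  proof
    have "W \<subseteq> N" unfolding W_def by (rule closure_minimal) (auto simp: Q.range_in Q.closed)
    then show "P ` W \<subseteq> P ` N" by blast
    obtain C where "projector C W" using projector_exists[OF W] by (auto simp: W_def)
    then interpret C: projector C W .
    show "P ` N \<subseteq> P ` W"
    proof
      fix v assume "v \<in> P ` N"
      then obtain n where n: "n \<in> N" "v = P n" by blast
      have "n - C n \<in> M\<^sup>\<bottom>"
      proof (rule orthogonal_compI)
        fix x assume "x \<in> M"
        then have "Q x \<in> W" by (auto simp: W_def intro: closure_subset[THEN subsetD])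
        then have "(n - C n) \<bullet> Q x = 0" by (rule C.inner_residual)
        moreover have "n - C n \<in> N"
          using n(1) C.range_in \<open>W \<subseteq> N\<close> Q.subspace by (blast intro: subspace_diff)
        ultimately show "(n - C n) \<bullet> x = 0" by (metis Q.fixed Q.self_adjoint)
      qed
      then have "P n = P (C n)" using P.zero_on_perp linear_diff[OF P.linear] by fastforce
      then show "v \<in> P ` W" using n C.range_in by auto
    qed
  qed
  ultimately show ?thesis by (simp add: complete_eq_closed)
qed

text \<open>For y in the range of P on N, the inner product of y with P n equals that of Q y with n.
  So the vectors y of a closed range with the norm of Q y at most 1 are weakly bounded, hence
  bounded.\<close>

lemma norm_quotient_pos_if_closed_image:
  fixes M N :: "'a::{real_inner, complete_space} set"
  assumes P: "projector P M" and Q: "projector Q N"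
    and cl: "closed (P ` N)"
  shows "norm_quotient Q (P ` N) > 0"
proof -
  interpret P: projector P M by fact
  interpret Q: projector Q N by fact
  have R: "subspace (P ` N)" by (intro linear_subspace_image P.linear Q.subspace)
  obtain C where "projector C (P ` N)" using projector_exists[OF R cl] .
  then interpret C: projector C "P ` N" .
  define F where "F = {y \<in> P ` N. norm (Q y) \<le> 1}"
  have "\<exists>c. \<forall>y\<in>F. \<bar>y \<bullet> h\<bar> \<le> c" for h
  proof -
    obtain n where n: "n \<in> N" "C h = P n" using C.range_in[of h] by blast
    have "\<bar>y \<bullet> h\<bar> \<le> norm n" if "y \<in> F" for y
    proof -
      have y: "y \<in> P ` N" "P y = y" "norm (Q y) \<le> 1"
        using that by (auto simp: F_def P.fixed P.range_in)
      have "y \<bullet> h = y \<bullet> P n" using y(1) n(2) C.fixed C.self_adjoint by metis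
      also have "\<dots> = Q y \<bullet> n" using y(2) n(1) P.self_adjoint Q.inner_proj by metis
      finally have "\<bar>y \<bullet> h\<bar> \<le> norm (Q y) * norm n" by (simp add: Cauchy_Schwarz_ineq2)
      also have "\<dots> \<le> norm n" using y(3) by (simp add: mult_left_le_one_le)
      finally show ?thesis .
    qed
    then show ?thesis by blast
  qed
  then obtain B where B: "B > 0" and F: "\<And>y. y \<in> F \<Longrightarrow> norm y \<le> B"
    using weakly_bounded_imp_bounded by blast
  have bound: "norm y \<le> B * norm (Q y)" if y: "y \<in> P ` N" for y
  proof (rule field_le_epsilon)
    fix e :: real assume "e > 0"
    \<comment> \<open>The summand e / B keeps the scaling factor finite when Q y = 0.\<close>
    define s where "s = norm (Q y) + e / B"
    have s: "s > 0" using \<open>e > 0\<close> B by (simp add: s_def add_nonneg_pos)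
    have "(1 / s) *\<^sub>R y \<in> P ` N" using R y by (rule subspace_scale)
    moreover have "norm (Q ((1 / s) *\<^sub>R y)) \<le> 1"
      using s \<open>e > 0\<close> B by (simp add: linear_cmul[OF Q.linear] s_def)
    ultimately have "norm ((1 / s) *\<^sub>R y) \<le> B" by (intro F) (simp add: F_def)
    then have "norm y \<le> B * s" using s by (simp add: field_simps)
    also have "\<dots> = B * norm (Q y) + e" using B by (simp add: s_def distrib_left)
    finally show "norm y \<le> B * norm (Q y) + e" .
  qed
  define t where "t = min 1 (1 / B)"
  have "t * norm y \<le> norm (Q y)" if "y \<in> P ` N" for y
  proof -
    have "t * norm y \<le> 1 / B * norm y" unfolding t_def by (intro mult_right_mono) auto
    also have "\<dots> \<le> norm (Q y)" using bound[OF that] B by (simp add: field_simps)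
    finally show ?thesis .
  qed
  then have "t \<le> norm_quotient Q (P ` N)"
    using le_norm_quotient_iff[OF Q, of t] by (simp add: t_def)
  moreover have "t > 0" using B by (simp add: t_def)
  ultimately show ?thesis by linarith
qed

lemma closed_image_iff_norm_quotient_pos:
  fixes M N :: "'a::{real_inner, complete_space} set"
  assumes "projector P M" and "projector Q N"
  shows "closed (P ` N) \<longleftrightarrow> norm_quotient Q (P ` N) > 0"
  using assms closed_image_if_norm_quotient_pos norm_quotient_pos_if_closed_image by blast

text \<open>The sum is the preimage of the projected subspace, and the projected subspace is the part
  of the sum orthogonal to N.\<close>

lemma closed_sum_iff_closed_perp_image:
  fixes M N :: "'a::real_inner set"
  assumes M: "subspace M" and Q: "projector Q N"
  shows "closed (M + N) \<longleftrightarrow> closed (perp_projector Q ` M)"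
proof -
  interpret Q: projector Q N by fact
  interpret Q': projector "perp_projector Q" "N\<^sup>\<bottom>" by (rule Q.projector_perp)
  have kernel: "x - y \<in> N \<longleftrightarrow> perp_projector Q x = perp_projector Q y" for x y
    using Q.perp_projector_eq_0_iff[of "x - y"] by (simp add: linear_diff[OF Q'.linear])
  have sum_iff: "x \<in> M + N \<longleftrightarrow> perp_projector Q x \<in> perp_projector Q ` M" for x
  proof
    assume "x \<in> M + N"
    then obtain m n where "m \<in> M" "n \<in> N" "x = m + n" by (rule set_plus_elim)
    then show "perp_projector Q x \<in> perp_projector Q ` M" using kernel[of x m] by auto
  next
    assume "perp_projector Q x \<in> perp_projector Q ` M"
    then obtain m where "m \<in> M" "x - m \<in> N" using kernel by blast
    then show "x \<in> M + N" using set_plus_intro[of m M "x - m" N] by simp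
  qed
  have preimage: "M + N = perp_projector Q -` (perp_projector Q ` M)"
    using sum_iff by blast
  have part: "perp_projector Q ` M = (M + N) \<inter> N\<^sup>\<bottom>"
  proof (rule set_eqI)
    fix x show "x \<in> perp_projector Q ` M \<longleftrightarrow> x \<in> (M + N) \<inter> N\<^sup>\<bottom>"
      using sum_iff[of x] Q'.fixed[of x] Q'.range_in by (cases "x \<in> N\<^sup>\<bottom>") auto
  qed
  show ?thesis
  proof
    assume "closed (M + N)"
    then show "closed (perp_projector Q ` M)"
      unfolding part by (intro closed_Int closed_orthogonal_comp)
  next
    assume "closed (perp_projector Q ` M)"
    then show "closed (M + N)"
      unfolding preimage
      by (intro continuous_closed_vimage linear_continuous_at Q'.bounded_linear)
  qed
qed

theorem lemma4p6:
  fixes D P D' P' :: "'a::{real_inner, complete_space} \<Rightarrow> 'a"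
    and DD PP :: "'a set" and \<kappa> :: real
  assumes "subspace DD" and "closed DD" and "orthogonal_projector D DD"
    and "subspace PP" and "closed PP" and "orthogonal_projector P PP"
  defines "D' \<equiv> perp_projector D"
    and "P' \<equiv> perp_projector P"
  defines "\<kappa> \<equiv> norm_quotient D (P' ` DD)"
  shows "dist_quotient PP DD = dist_quotient DD PP
    \<and> dist_quotient DD PP = dist_quotient (DD\<^sup>\<bottom>) (PP\<^sup>\<bottom>)
    \<and> dist_quotient (DD\<^sup>\<bottom>) (PP\<^sup>\<bottom>) = dist_quotient (PP\<^sup>\<bottom>) (DD\<^sup>\<bottom>)
    \<and> dist_quotient (PP\<^sup>\<bottom>) (DD\<^sup>\<bottom>) = \<kappa>
    \<and> \<kappa> = norm_quotient P (D' ` PP)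
    \<and> norm_quotient P (D' ` PP) = norm_quotient D' (P ` (DD\<^sup>\<bottom>))
    \<and> norm_quotient D' (P ` (DD\<^sup>\<bottom>)) = norm_quotient P' (D ` (PP\<^sup>\<bottom>))
    \<and> (closed (P' ` DD) \<longleftrightarrow> \<kappa> > 0)
    \<and> (closed (DD + PP) \<longleftrightarrow> \<kappa> > 0)
    \<and> (closed (DD\<^sup>\<bottom> + PP\<^sup>\<bottom>) \<longleftrightarrow> \<kappa> > 0)
    \<and> (closed (P ` (DD\<^sup>\<bottom>)) \<longleftrightarrow> \<kappa> > 0)"
proof -
  have d: "projector D DD" and p: "projector P PP" by (rule projector.intro; fact)+
  have d': "projector D' (DD\<^sup>\<bottom>)" and p': "projector P' (PP\<^sup>\<bottom>)"
    unfolding D'_def P'_def using d p projector.projector_perp by blast+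
  have dd: "perp_projector D' = D" "(DD\<^sup>\<bottom>)\<^sup>\<bottom> = DD"
    and pp: "perp_projector P' = P" "(PP\<^sup>\<bottom>)\<^sup>\<bottom> = PP"
    unfolding D'_def P'_def
    using d p by (simp_all add: projector.perp_perp_projector projector.perp_perp)
  have "dist_quotient PP DD = norm_quotient D' (P ` (DD\<^sup>\<bottom>))"
    "dist_quotient DD PP = norm_quotient P' (D ` (PP\<^sup>\<bottom>))"
    unfolding D'_def P'_def using d p by (simp_all add: dist_quotient_eq_norm_quotient)
  moreover have "dist_quotient (PP\<^sup>\<bottom>) (DD\<^sup>\<bottom>) = \<kappa>"
    "dist_quotient (DD\<^sup>\<bottom>) (PP\<^sup>\<bottom>) = norm_quotient P (D' ` PP)"
    using dist_quotient_eq_norm_quotient[OF p' d'] dist_quotient_eq_norm_quotient[OF d' p']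
    by (simp_all add: dd pp \<kappa>_def)
  moreover have "dist_quotient PP DD = dist_quotient DD PP"
    "dist_quotient (PP\<^sup>\<bottom>) (DD\<^sup>\<bottom>) = dist_quotient (DD\<^sup>\<bottom>) (PP\<^sup>\<bottom>)"
    using dist_quotient_commute[OF p d] dist_quotient_commute[OF p' d'] .
  moreover have "norm_quotient D' (P ` (DD\<^sup>\<bottom>)) = norm_quotient P (D' ` PP)"
    by (rule norm_quotient_swap[OF p d'])
  moreover have "closed (P' ` DD) \<longleftrightarrow> \<kappa> > 0"
    unfolding \<kappa>_def by (rule closed_image_iff_norm_quotient_pos[OF p' d])
  moreover have "closed (P ` (DD\<^sup>\<bottom>)) \<longleftrightarrow> norm_quotient D' (P ` (DD\<^sup>\<bottom>)) > 0"
    by (rule closed_image_iff_norm_quotient_pos[OF p d'])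
  moreover have "closed (DD + PP) \<longleftrightarrow> closed (P' ` DD)"
    unfolding P'_def by (rule closed_sum_iff_closed_perp_image[OF \<open>subspace DD\<close> p])
  moreover have "closed (DD\<^sup>\<bottom> + PP\<^sup>\<bottom>) \<longleftrightarrow> closed (P ` (DD\<^sup>\<bottom>))"
    using closed_sum_iff_closed_perp_image[OF subspace_orthogonal_comp p'] by (simp add: pp)
  ultimately show ?thesis by simp
qed

end
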